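(* Let $n,i,j$ be integers with $1\le i<j\le n$, let $k$ be a field, let $R=k[x_1,\dots,x_n]$, let $I=(x_1^2,\dots,x_n^2)+\mathrm{RLex}(x_ix_j)$, and let $A=R/I$. Then the Hilbert series $\mathrm{HS}(A;t)$ is a real-rooted polynomial. In particular, its coefficients form a unimodal and log-concave sequence. Moreover, $\mathrm{HS}(A;t)$ is symmetric if and only if $j-i-1=1$.
   Context: The reverse lexicographic order with $x_1>\cdots>x_n$: for two monomials of the same degree, $x_1^{a_1}\cdots x_n^{a_n}>x_1^{b_1}\cdots x_n^{b_n}$ if the last non-zero entry of $(a_1,\dots,a_n)-(b_1,\dots,b_n)$ is negative. For $1\le i<j\le n$, $\mathrm{RLex}(x_ix_j)$ is the ideal of $R$ generated by all square-free monomials of degree 2 that are greater than or equal to $x_ix_j$ in this order; that is, by all $x_ax_b$ with $1\le a<b\le j-1$ together with $x_ax_j$ for $1\le a\le i$. The Hilbert series of a standard graded $k$-algebra $A=\bigoplus_{d\ge0}A_d$ is $\mathrm{HS}(A;t)=\sum_{d\ge 0}\dim_k(A_d)\,t^d$. A polynomial with real coefficients is real-rooted if all its complex roots are real. A sequence $h_0,\dots,h_D$ is unimodal if $h_0\le\cdots\le h_m\ge\cdots\ge h_D$ for some $m$, and log-concave if $h_d^2\ge h_{d-1}h_{d+1}$ for all $0<d<D$. A polynomial $\sum_{d=0}^D h_dt^d$ of degree $D$ is symmetric if $h_d=h_{D-d}$ for all $0\le d\le D$. *)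

theory Defs
  imports
    "HOL-Library.Poly_Mapping"
    "HOL-Computational_Algebra.Polynomial_FPS"
    "HOL-Algebra.Embedded_Algebras"
    "HOL-Algebra.QuotRing"
begin

section \<open>Polynomial rings in finitely many variables\<close>

text \<open>A monomial is identified with its exponent vector, a finitely supported function
  on the indices of the variables; a polynomial is a finitely supported function from monomials
  to the coefficient field. The type has countably many variables, so the ring
  $k[x_1,\dots,x_n]$ is a record whose carrier consists of the polynomials
  involving only $x_1,\dots,x_n$.\<close>

type_synonym mon = "nat \<Rightarrow>\<^sub>0 nat"
type_synonym 'k mpoly = "mon \<Rightarrow>\<^sub>0 'k"

definition monomials :: "nat \<Rightarrow> mon set" where
  "monomials n = {m. Poly_Mapping.keys m \<subseteq> {1..n}}"

definition mon_deg :: "mon \<Rightarrow> nat" where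
  "mon_deg m = (\<Sum>l\<in>Poly_Mapping.keys m. Poly_Mapping.lookup m l)"

definition mon_squarefree :: "mon \<Rightarrow> bool" where
  "mon_squarefree m \<longleftrightarrow> (\<forall>l. Poly_Mapping.lookup m l \<le> 1)"

definition mon_var :: "nat \<Rightarrow> mon" where
  "mon_var l = Poly_Mapping.single l 1"

definition mpoly_of_mon :: "mon \<Rightarrow> 'k::field mpoly" where
  "mpoly_of_mon m = Poly_Mapping.single m 1"

definition mpoly_ring :: "nat \<Rightarrow> 'k::field mpoly ring" where
  "mpoly_ring n =
     \<lparr>carrier = {f. Poly_Mapping.keys f \<subseteq> monomials n}, mult = (*), one = 1, zero = 0, add = (+)\<rparr>"

lemma cring_mpoly_ring: "cring (mpoly_ring n :: 'k::field mpoly ring)"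
proof (rule cringI)
  show "abelian_group (mpoly_ring n :: 'k mpoly ring)"
  proof (rule abelian_groupI)
    fix x :: "'k mpoly" assume "x \<in> carrier (mpoly_ring n)"
    then show "\<exists>y\<in>carrier (mpoly_ring n). y \<oplus>\<^bsub>mpoly_ring n\<^esub> x = \<zero>\<^bsub>mpoly_ring n\<^esub>"
      by (intro bexI[of _ "- x"]) (auto simp: mpoly_ring_def)
  qed (use Poly_Mapping.keys_add in \<open>fastforce simp: mpoly_ring_def add_ac\<close>)+
  show "comm_monoid (mpoly_ring n :: 'k mpoly ring)"
  proof (rule comm_monoidI)
    fix x y :: "'k mpoly"
    assume "x \<in> carrier (mpoly_ring n)" "y \<in> carrier (mpoly_ring n)"
    moreover have "a + b \<in> monomials n" if "a \<in> monomials n" "b \<in> monomials n" for a b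
      using that Poly_Mapping.keys_add[of a b] by (auto simp: monomials_def)
    ultimately show "x \<otimes>\<^bsub>mpoly_ring n\<^esub> y \<in> carrier (mpoly_ring n)"
      using Poly_Mapping.keys_mult[of x y] by (fastforce simp: mpoly_ring_def)
  qed (auto simp: mpoly_ring_def monomials_def mult_ac)
qed (auto simp: mpoly_ring_def algebra_simps)

definition mpoly_consts :: "'k::field mpoly set" where
  "mpoly_consts = range (Poly_Mapping.single 0)"

definition homogeneous_part :: "nat \<Rightarrow> nat \<Rightarrow> 'k::field mpoly set" where
  "homogeneous_part n d = {f \<in> carrier (mpoly_ring n). \<forall>m\<in>Poly_Mapping.keys f. mon_deg m = d}"


section \<open>The reverse lexicographic order and the ideals it defines\<close>

text \<open>The last non-zero entry of the difference of the exponent vectors of \<open>u\<close> and \<open>v\<close>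
  is negative.\<close>

definition revlex_greater :: "mon \<Rightarrow> mon \<Rightarrow> bool" where
  "revlex_greater u v \<longleftrightarrow> mon_deg u = mon_deg v \<and>
     (\<exists>l. Poly_Mapping.lookup u l < Poly_Mapping.lookup v l \<and>
          (\<forall>l'>l. Poly_Mapping.lookup u l' = Poly_Mapping.lookup v l'))"

definition RLex_gens :: "nat \<Rightarrow> mon \<Rightarrow> mon set" where
  "RLex_gens n u = {m \<in> monomials n. mon_squarefree m \<and> mon_deg m = 2 \<and>
     (m = u \<or> revlex_greater m u)}"

definition RLex :: "nat \<Rightarrow> mon \<Rightarrow> 'k::field mpoly set" where
  "RLex n u = Idl\<^bsub>mpoly_ring n\<^esub> (mpoly_of_mon ` RLex_gens n u)"

definition squares_ideal :: "nat \<Rightarrow> 'k::field mpoly set" where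
  "squares_ideal n =
     Idl\<^bsub>mpoly_ring n\<^esub> ((\<lambda>l. mpoly_of_mon (mon_var l) ^ 2) ` {1..n})"


section \<open>Hilbert series\<close>

text \<open>\<open>K\<close> is the image of the coefficient field in \<open>A\<close>, and \<open>G d\<close> is the component of degree \<open>d\<close>.\<close>

definition hilbert_series :: "('a, 'b) ring_scheme \<Rightarrow> 'a set \<Rightarrow> (nat \<Rightarrow> 'a set) \<Rightarrow> real fps" where
  "hilbert_series A K G = Abs_fps (\<lambda>d. of_nat (ring.dim A K (G d)))"

text \<open>The Hilbert series of $k[x_1,\dots,x_n]/I$ for a homogeneous ideal \<open>I\<close>, graded by the images
  of the homogeneous components of the polynomial ring.\<close>

definition quotient_hilbert_series :: "nat \<Rightarrow> 'k::field mpoly set \<Rightarrow> real fps" where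
  "quotient_hilbert_series n I =
     hilbert_series (mpoly_ring n Quot I)
       ((\<lambda>f. I +>\<^bsub>mpoly_ring n\<^esub> f) ` mpoly_consts)
       (\<lambda>d. (\<lambda>f. I +>\<^bsub>mpoly_ring n\<^esub> f) ` homogeneous_part n d)"


section \<open>Properties of real polynomials and their coefficients\<close>

definition real_rooted :: "real poly \<Rightarrow> bool" where
  "real_rooted p \<longleftrightarrow> (\<forall>z::complex. poly (map_poly complex_of_real p) z = 0 \<longrightarrow> z \<in> \<real>)"

definition unimodal_seq :: "(nat \<Rightarrow> real) \<Rightarrow> nat \<Rightarrow> bool" where
  "unimodal_seq h D \<longleftrightarrow> (\<exists>m\<le>D. (\<forall>d<m. h d \<le> h (Suc d)) \<and> (\<forall>d. m \<le> d \<and> d < D \<longrightarrow> h (Suc d) \<le> h d))"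

definition log_concave_seq :: "(nat \<Rightarrow> real) \<Rightarrow> nat \<Rightarrow> bool" where
  "log_concave_seq h D \<longleftrightarrow> (\<forall>d. 0 < d \<and> d < D \<longrightarrow> h d ^ 2 \<ge> h (d - 1) * h (d + 1))"

definition symmetric_poly :: "real poly \<Rightarrow> bool" where
  "symmetric_poly p \<longleftrightarrow>
     (\<forall>d\<le>Polynomial.degree p. poly.coeff p d = poly.coeff p (Polynomial.degree p - d))"

end

theory Submission
  imports Defs
begin

text \<open>Both ideals are generated by monomials, so $I$ consists of the polynomials supported on a set
  of monomials, and $\dim_k A_d$ counts the monomials of degree $d$ outside of this set. These are
  the square-free monomials $x_S$ such that $S \cap \{1,\dots,j\}$ is empty, or $\{a\}$ for some $a \le j$,
  or $\{a,j\}$ for some $i < a < j$. Hence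
  $\mathrm{HS}(A;t) = (1 + jt + (j-i-1)t^2)(1+t)^{n-j}$. The quadratic factor has positive discriminant
  $j^2 - 4(j-i-1) \ge (j-2)^2 + 4$. Log-concavity of positive coefficients is preserved under
  multiplication by $1+t$. The constant coefficient is $1$, so symmetry forces the leading
  coefficient, which is $j-i-1$ or (if this vanishes) $j \ge 2$, to be $1$ as well.\<close>

section \<open>Monomial ideals\<close>

text \<open>The \<open>k\<close>-span of the monomials in \<open>S\<close>. The carrier of the ring,
  monomial ideals and the spans of standard monomials all have this form, so questions about them
  reduce to sets of monomials.\<close>

definition polys_on :: "mon set \<Rightarrow> 'k::field mpoly set" where
  "polys_on S = {f. Poly_Mapping.keys f \<subseteq> S}"

text \<open>Exponent vectors add when monomials multiply: these are the monomials divisible by some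
  member of \<open>G\<close>, with cofactor in \<open>x_1,...,x_n\<close>.\<close>

definition multiples :: "nat \<Rightarrow> mon set \<Rightarrow> mon set" where
  "multiples n G = {u + g | u g. u \<in> monomials n \<and> g \<in> G}"

lemma monomials_0 [simp]: "0 \<in> monomials n"
  by (simp add: monomials_def)

lemma monomials_add: "a \<in> monomials n \<Longrightarrow> b \<in> monomials n \<Longrightarrow> a + b \<in> monomials n"
  using Poly_Mapping.keys_add[of a b] by (auto simp: monomials_def)

lemma multiples_subset: "G \<subseteq> monomials n \<Longrightarrow> multiples n G \<subseteq> monomials n"
  by (auto simp: multiples_def intro: monomials_add)

lemma multiples_Un: "multiples n (G \<union> H) = multiples n G \<union> multiples n H"
  by (auto simp: multiples_def)

lemma mpoly_ring_sel [simp]: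
  "carrier (mpoly_ring n) = polys_on (monomials n)"
  "x \<otimes>\<^bsub>mpoly_ring n\<^esub> y = x * y" "x \<oplus>\<^bsub>mpoly_ring n\<^esub> y = x + y"
  "\<one>\<^bsub>mpoly_ring n\<^esub> = 1" "\<zero>\<^bsub>mpoly_ring n\<^esub> = 0"
  by (auto simp: mpoly_ring_def polys_on_def)

lemma zero_in_polys_on [simp]: "0 \<in> polys_on S"
  by (simp add: polys_on_def)

lemma single_in_polys_on: "m \<in> S \<Longrightarrow> Poly_Mapping.single m c \<in> polys_on S"
  by (simp add: polys_on_def)

lemma polys_on_add: "f \<in> polys_on S \<Longrightarrow> g \<in> polys_on S \<Longrightarrow> f + g \<in> polys_on S"
  using Poly_Mapping.keys_add[of f g] by (auto simp: polys_on_def)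

lemma polys_on_uminus: "f \<in> polys_on S \<Longrightarrow> - f \<in> polys_on S"
  by (auto simp: polys_on_def)

lemma polys_on_mono: "S \<subseteq> T \<Longrightarrow> polys_on S \<subseteq> polys_on T"
  by (auto simp: polys_on_def)

lemma polys_on_insertE:
  assumes "f \<in> polys_on (insert m S)"
  obtains g c where "g \<in> polys_on S" "f = g + Poly_Mapping.single m c"
proof
  let ?g = "f - Poly_Mapping.single m (Poly_Mapping.lookup f m)"
  show "f = ?g + Poly_Mapping.single m (Poly_Mapping.lookup f m)"
    by simp
  have "x \<in> S" if "Poly_Mapping.lookup ?g x \<noteq> 0" for x
    using that assms
    by (cases "x = m") (auto simp: polys_on_def lookup_minus lookup_single_not_eq in_keys_iff)
  then show "?g \<in> polys_on S"
    by (auto simp: polys_on_def in_keys_iff)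
qed

text \<open>\<open>S\<close> may be infinite, but each polynomial has finite support. The induction
  therefore runs over finite subsets \<open>T\<close> of \<open>S\<close>, splitting off one term at
  a time.\<close>

lemma polys_on_induct [consumes 1, case_names zero add]:
  assumes "f \<in> polys_on S" "P 0"
    and "\<And>f m c. P f \<Longrightarrow> m \<in> S \<Longrightarrow> P (f + Poly_Mapping.single m c)"
  shows "P f"
proof -
  have "P g" if "finite T" "T \<subseteq> S" "g \<in> polys_on T" for g T
    using that
  proof (induction T arbitrary: g)
    case empty
    then show ?case using assms(2) by (simp add: polys_on_def)
  next
    case (insert m T)
    then show ?case
      using assms(3) by (metis insert_subset polys_on_insertE)
  qed
  from this[of "Poly_Mapping.keys f" f] show ?thesis
    using assms(1) by (auto simp: polys_on_def)
qed

text \<open>Each term of a polynomial supported on the union can be assigned to one of the summands.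
  This is used both to add the two ideals and to split a polynomial into its standard part and a
  part in the ideal.\<close>

lemma set_add_polys_on:
  "polys_on S <+>\<^bsub>mpoly_ring n\<^esub> polys_on T = (polys_on (S \<union> T) :: 'k::field mpoly set)"
proof
  let ?L = "polys_on S <+>\<^bsub>mpoly_ring n\<^esub> polys_on T :: 'k mpoly set"
  let ?R = "polys_on (S \<union> T) :: 'k mpoly set"
  show "?L \<subseteq> ?R"
    using polys_on_mono[of S "S \<union> T"] polys_on_mono[of T "S \<union> T"]
    by (auto simp: set_add_def' intro!: polys_on_add)
  show "polys_on (S \<union> T) \<subseteq> ?L"
  proof
    fix f :: "'k mpoly" assume "f \<in> ?R"
    then show "f \<in> ?L"
    proof (induction rule: polys_on_induct)
      case zero
      have "0 + 0 \<in> ?L"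
        unfolding set_add_def' using zero_in_polys_on by fastforce
      then show ?case by simp
    next
      case (add f m c)
      then obtain g h where gh: "g \<in> polys_on S" "h \<in> polys_on T" "f = g + h"
        by (auto simp: set_add_def')
      let ?s = "Poly_Mapping.single m c"
      have "\<exists>g'\<in>polys_on S. \<exists>h'\<in>polys_on T. f + ?s = g' + h'"
      proof (cases "m \<in> S")
        case True
        then have "g + ?s \<in> polys_on S"
          using gh by (simp add: polys_on_add single_in_polys_on)
        then show ?thesis
          using gh by (intro bexI[of _ "g + ?s"] bexI[of _ h]) (simp_all add: add_ac)
      next
        case False
        then have "h + ?s \<in> polys_on T"
          using gh add by (simp add: polys_on_add single_in_polys_on)
        then show ?thesis
          using gh by (intro bexI[of _ g] bexI[of _ "h + ?s"]) (simp_all add: add_ac)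
      qed
      then show ?case by (auto simp: set_add_def')
    qed
  qed
qed

lemma uminus_mpoly_ring:
  fixes f :: "'k::field mpoly"
  assumes "f \<in> polys_on (monomials n)"
  shows "\<ominus>\<^bsub>mpoly_ring n\<^esub> f = - f"
proof -
  interpret cring "mpoly_ring n :: 'k mpoly ring" by (rule cring_mpoly_ring)
  have "- f \<in> carrier (mpoly_ring n)" "f \<in> carrier (mpoly_ring n)"
    using assms polys_on_uminus by auto
  then show ?thesis by (metis minus_equality mpoly_ring_sel(3,5) ab_left_minus)
qed

text \<open>The support of a product lies in the sumset of the supports, so closure of
  \<open>S\<close> under adding exponents gives absorption.\<close>

lemma ideal_polys_on:
  assumes S: "S \<subseteq> monomials n" and add: "\<And>a b. a \<in> S \<Longrightarrow> b \<in> monomials n \<Longrightarrow> b + a \<in> S"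
  shows "ideal (polys_on S :: 'k::field mpoly set) (mpoly_ring n)"
proof -
  interpret cring "mpoly_ring n :: 'k mpoly ring" by (rule cring_mpoly_ring)
  have mult: "x * a \<in> polys_on S" if "a \<in> polys_on S" "x \<in> polys_on (monomials n)" for a x :: "'k mpoly"
    using that keys_mult[of x a] add by (fastforce simp: polys_on_def)
  show ?thesis
  proof (rule idealI)
    show "subgroup (polys_on S) (add_monoid (mpoly_ring n :: 'k mpoly ring))"
    proof (rule add.subgroupI)
      show "polys_on S \<noteq> ({} :: 'k mpoly set)"
        using zero_in_polys_on by blast
      fix a :: "'k mpoly" assume "a \<in> polys_on S"
      then show "\<ominus>\<^bsub>mpoly_ring n\<^esub> a \<in> polys_on S"
        using polys_on_mono[OF S] polys_on_uminus by (subst uminus_mpoly_ring) auto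
    qed (use polys_on_mono[OF S] in \<open>auto intro: polys_on_add\<close>)
  qed (use mult in \<open>auto simp: mult.commute ring_axioms\<close>)
qed

lemma ideal_multiples:
  assumes "G \<subseteq> monomials n"
  shows "ideal (polys_on (multiples n G) :: 'k::field mpoly set) (mpoly_ring n)"
proof (rule ideal_polys_on)
  show "multiples n G \<subseteq> monomials n"
    by (rule multiples_subset[OF assms])
  show "b + a \<in> multiples n G" if "a \<in> multiples n G" "b \<in> monomials n" for a b
    using that unfolding multiples_def by (auto simp flip: add.assoc) (metis monomials_add)
qed

text \<open>One inclusion is minimality of the generated ideal. For the other, a term with exponent
  \<open>u + g\<close> is a scalar multiple of the monomial \<open>u\<close> times the generator
  \<open>g\<close>.\<close>

lemma genideal_mpoly_of_mon:
  assumes "G \<subseteq> monomials n"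
  shows "Idl\<^bsub>mpoly_ring n\<^esub> (mpoly_of_mon ` G) = (polys_on (multiples n G) :: 'k::field mpoly set)"
proof
  let ?M = "polys_on (multiples n G) :: 'k mpoly set"
  let ?J = "Idl\<^bsub>mpoly_ring n\<^esub> (mpoly_of_mon ` G) :: 'k mpoly set"
  interpret cring "mpoly_ring n :: 'k mpoly ring" by (rule cring_mpoly_ring)
  have "ideal ?M (mpoly_ring n)"
    by (rule ideal_multiples[OF assms])
  moreover have "mpoly_of_mon ` G \<subseteq> ?M"
    by (force simp: mpoly_of_mon_def multiples_def intro!: single_in_polys_on intro: exI[of _ 0])
  ultimately show "?J \<subseteq> ?M"
    by (rule genideal_minimal)
  have G: "mpoly_of_mon ` G \<subseteq> carrier (mpoly_ring n :: 'k mpoly ring)"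
    using assms by (auto simp: mpoly_of_mon_def intro!: single_in_polys_on)
  then interpret J: ideal "?J" "mpoly_ring n"
    by (rule genideal_ideal)
  show "?M \<subseteq> ?J"
  proof
    fix f :: "'k mpoly" assume "f \<in> ?M"
    then show "f \<in> ?J"
    proof (induction rule: polys_on_induct)
      case zero
      then show ?case using J.zero_closed by simp
    next
      case (add f m c)
      then obtain u g where u: "u \<in> monomials n" "g \<in> G" "m = u + g"
        by (auto simp: multiples_def)
      then have "mpoly_of_mon g \<in> ?J"
        using genideal_self[OF G] by blast
      then have "Poly_Mapping.single u c * mpoly_of_mon g \<in> ?J"
        using J.I_l_closed[of "mpoly_of_mon g" "Poly_Mapping.single u c"] u
        by (simp add: single_in_polys_on)
      then have "Poly_Mapping.single m c \<in> ?J"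
        by (simp add: u mpoly_of_mon_def mult_single)
      then show ?case using J.a_closed[OF add.IH] by simp
    qed
  qed
qed

section \<open>Standard monomials\<close>

lemma subfield_mpoly_consts:
  "subfield mpoly_consts (mpoly_ring n :: 'k::field mpoly ring)"
proof -
  let ?R = "mpoly_ring n :: 'k mpoly ring"
  interpret cring "mpoly_ring n :: 'k mpoly ring" by (rule cring_mpoly_ring)
  have carr: "(mpoly_consts :: 'k mpoly set) \<subseteq> carrier (?R)"
    by (auto simp: mpoly_consts_def intro: single_in_polys_on)
  have sub: "subring mpoly_consts (?R)"
  proof (rule subringI[OF carr])
    show "\<one>\<^bsub>?R\<^esub> \<in> mpoly_consts"
      by (auto simp: mpoly_consts_def simp flip: single_one)
    show "\<ominus>\<^bsub>?R\<^esub> h \<in> mpoly_consts" if "h \<in> mpoly_consts" for h :: "'k mpoly"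
      using that carr by (subst uminus_mpoly_ring) (auto simp: mpoly_consts_def simp flip: single_uminus)
  qed (auto simp: mpoly_consts_def mult_single simp flip: single_add)
  show ?thesis
  proof (rule subfieldI)
    show "subcring mpoly_consts (?R)"
      by (rule subcringI[OF sub]) (simp add: mult.commute)
    show "Units (?R \<lparr>carrier := mpoly_consts\<rparr>) = mpoly_consts - {\<zero>\<^bsub>?R\<^esub>}"
    proof (intro equalityI subsetI)
      fix x :: "'k mpoly"
      assume "x \<in> Units (?R \<lparr>carrier := mpoly_consts\<rparr>)"
      then show "x \<in> mpoly_consts - {\<zero>\<^bsub>?R\<^esub>}"
        by (auto simp: Units_def)
    next
      fix x :: "'k mpoly"
      assume "x \<in> mpoly_consts - {\<zero>\<^bsub>?R\<^esub>}"
      then obtain c where c: "x = Poly_Mapping.single 0 c" "c \<noteq> 0"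
        unfolding mpoly_consts_def by force
      let ?y = "Poly_Mapping.single 0 (inverse c) :: 'k mpoly"
      have "?y * x = 1" "x * ?y = 1" "?y \<in> mpoly_consts" "x \<in> mpoly_consts"
        using c by (auto simp: mult_single mpoly_consts_def)
      then show "x \<in> Units (?R \<lparr>carrier := mpoly_consts\<rparr>)"
        unfolding Units_def by auto
    qed
  qed
qed

text \<open>The classes of the monomials in \<open>S\<close> form a basis over the image of the
  constants: disjointness from \<open>B\<close> makes them independent. Induction on
  \<open>S\<close> adjoins one basis vector at a time.\<close>

lemma dim_quotient_polys_on:
  fixes B :: "mon set" and n :: nat
  defines "I \<equiv> polys_on B :: 'k::field mpoly set" and "R \<equiv> mpoly_ring n :: 'k mpoly ring"
  assumes I: "ideal I R" and B: "B \<subseteq> monomials n" "0 \<notin> B"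
    and S: "finite S" "S \<subseteq> monomials n - B"
  shows "ring.dim (R Quot I) ((+>\<^bsub>R\<^esub>) I ` mpoly_consts) ((+>\<^bsub>R\<^esub>) I ` polys_on S) = card S"
proof -
  interpret R: cring R unfolding R_def by (rule cring_mpoly_ring)
  interpret I: ideal I R by (rule I)
  interpret h: ring_hom_ring R "R Quot I" "(+>\<^bsub>R\<^esub>) I" by (rule I.rcos_ring_hom_ring)
  let ?p = "(+>\<^bsub>R\<^esub>) I" and ?K = "(+>\<^bsub>R\<^esub>) I ` mpoly_consts"
  have eq_iff: "?p f = ?p g \<longleftrightarrow> f - g \<in> I" if "f \<in> carrier R" "g \<in> carrier R" for f g
    using R.quotient_eq_iff_same_a_r_cos[OF I that] that
    by (simp add: R_def a_minus_def uminus_mpoly_ring)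
  have K: "subfield ?K (R Quot I)"
  proof (rule h.img_is_subfield)
    show "subfield mpoly_consts R" unfolding R_def by (rule subfield_mpoly_consts)
    \<comment> \<open>The polynomial 1 has support \<open>{0}\<close>, so
      \<open>0 \<notin> B\<close> makes the quotient nonzero; hence the constants map onto a
      field.\<close>
    have "1 - 0 \<notin> I" using B by (simp add: I_def polys_on_def)
    then have "?p 1 \<noteq> ?p 0" using eq_iff[of 1 0] by (simp add: R_def polys_on_def)
    then show "\<one>\<^bsub>R Quot I\<^esub> \<noteq> \<zero>\<^bsub>R Quot I\<^esub>"
      using h.hom_one h.hom_zero by (simp add: R_def)
  qed
  \<comment> \<open>The predicate \<open>dimension\<close> is inductive: it starts at the zero space
    and grows by adjoining a line through a vector outside the current space. This matches finite
    induction on \<open>S\<close>.\<close>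
  have dim: "ring.dimension (R Quot I) (card S) ?K (?p ` polys_on S)"
    using S
  proof (induction S)
    case empty
    have "polys_on {} = {\<zero>\<^bsub>R\<^esub>}" by (auto simp: polys_on_def R_def)
    then have "?p ` polys_on {} = {\<zero>\<^bsub>R Quot I\<^esub>}"
      using h.hom_zero by simp
    then show ?case using h.S.dimension.zero_dim by simp
  next
    case (insert m S)
    let ?m = "mpoly_of_mon m :: 'k mpoly"
    have sub: "polys_on S \<subseteq> carrier R" and m: "?m \<in> carrier R"
      using insert.prems polys_on_mono[of S "monomials n"]
      by (auto simp: R_def mpoly_of_mon_def intro: single_in_polys_on)
    have const_carrier: "Poly_Mapping.single 0 c \<in> carrier R" for c
      by (simp add: R_def single_in_polys_on)
    \<comment> \<open>Compare coefficients at \<open>m\<close>: it is 0 in every element of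
      \<open>I\<close> because \<open>m \<notin> B\<close>, but it is 1 in
      \<open>?m - f\<close>.\<close>
    have notin: "?p ?m \<notin> ?p ` polys_on S"
    proof
      assume "?p ?m \<in> ?p ` polys_on S"
      then obtain f where f: "f \<in> polys_on S" "?p ?m = ?p f" by blast
      then have "?m - f \<in> I" using eq_iff[of ?m f] m sub by blast
      then have "Poly_Mapping.lookup (?m - f) m = 0"
        using insert.prems by (auto simp: I_def polys_on_def in_keys_iff)
      moreover have "Poly_Mapping.lookup f m = 0"
        using f insert.hyps by (auto simp: polys_on_def in_keys_iff)
      ultimately show False by (simp add: lookup_minus mpoly_of_mon_def)
    qed
    have "?p (Poly_Mapping.single 0 c * ?m + g) = ?p (Poly_Mapping.single 0 c) \<otimes>\<^bsub>R Quot I\<^esub> ?p ?m \<oplus>\<^bsub>R Quot I\<^esub> ?p g"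
      if "g \<in> polys_on S" for c g
    proof -
      have "?p (Poly_Mapping.single 0 c \<otimes>\<^bsub>R\<^esub> ?m \<oplus>\<^bsub>R\<^esub> g) = ?p (Poly_Mapping.single 0 c) \<otimes>\<^bsub>R Quot I\<^esub> ?p ?m \<oplus>\<^bsub>R Quot I\<^esub> ?p g"
        using that sub m const_carrier by (subst h.hom_add h.hom_mult; auto)+
      then show ?thesis by (simp add: R_def)
    qed
    then have "h.S.line_extension ?K (?p ?m) (?p ` polys_on S) =
        {?p (Poly_Mapping.single 0 c * ?m + g) | c g. g \<in> polys_on S}"
      unfolding h.S.line_extension_def set_add_def' r_coset_def mpoly_consts_def
      by (auto; metis)
    also have "\<dots> = ?p ` {Poly_Mapping.single 0 c * ?m + g | c g. g \<in> polys_on S}"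
      by blast
    also have "{Poly_Mapping.single 0 c * ?m + g | c g. g \<in> polys_on S} = polys_on (insert m S)"
    proof (intro equalityI subsetI)
      fix f assume "f \<in> {Poly_Mapping.single 0 c * ?m + g | c g. g \<in> polys_on S}"
      then show "f \<in> polys_on (insert m S)"
        using polys_on_mono[of S "insert m S"]
        by (auto simp: mpoly_of_mon_def mult_single intro!: polys_on_add single_in_polys_on)
    next
      fix f :: "'k mpoly" assume "f \<in> polys_on (insert m S)"
      then obtain g c where "g \<in> polys_on S" "f = g + Poly_Mapping.single m c"
        by (rule polys_on_insertE)
      then show "f \<in> {Poly_Mapping.single 0 c * ?m + g | c g. g \<in> polys_on S}"
        by (auto simp: mpoly_of_mon_def mult_single add.commute)
    qed
    finally have "h.S.line_extension ?K (?p ?m) (?p ` polys_on S) = ?p ` polys_on (insert m S)" .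
    then show ?case
      using h.S.dimension.Suc_dim[OF h.hom_closed[OF m] notin insert.IH] insert by auto
  qed
  show ?thesis
    using h.S.dimI[OF K dim] by (simp add: over_def)
qed

text \<open>Modulo \<open>I\<close>, a homogeneous polynomial may drop its terms in
  \<open>B\<close>. The degree \<open>d\<close> component is thus the image of the span of the
  standard monomials of degree \<open>d\<close>, and these are counted by the preceding
  lemma.\<close>

lemma quotient_hilbert_series_polys_on:
  fixes B :: "mon set" and n :: nat
  defines "I \<equiv> polys_on B :: 'k::field mpoly set"
  assumes I: "ideal I (mpoly_ring n)" and B: "B \<subseteq> monomials n" "0 \<notin> B"
    and fin: "finite (monomials n - B)"
  shows "quotient_hilbert_series n I = Abs_fps (\<lambda>d. real (card {m \<in> monomials n - B. mon_deg m = d}))"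
proof -
  let ?R = "mpoly_ring n :: 'k mpoly ring"
  interpret R: cring ?R by (rule cring_mpoly_ring)
  have "(+>\<^bsub>?R\<^esub>) I ` homogeneous_part n d = (+>\<^bsub>?R\<^esub>) I ` polys_on {m \<in> monomials n - B. mon_deg m = d}" for d
  proof
    show "(+>\<^bsub>?R\<^esub>) I ` polys_on {m \<in> monomials n - B. mon_deg m = d} \<subseteq> (+>\<^bsub>?R\<^esub>) I ` homogeneous_part n d"
      by (rule image_mono) (auto simp: homogeneous_part_def polys_on_def)
    show "(+>\<^bsub>?R\<^esub>) I ` homogeneous_part n d \<subseteq> (+>\<^bsub>?R\<^esub>) I ` polys_on {m \<in> monomials n - B. mon_deg m = d}"
    proof (rule image_subsetI)
      fix f :: "'k mpoly" assume f: "f \<in> homogeneous_part n d"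
      then have "f \<in> polys_on ({m \<in> monomials n - B. mon_deg m = d} \<union> B)"
        by (auto simp: homogeneous_part_def polys_on_def)
      then obtain g b where gb: "g \<in> polys_on {m \<in> monomials n - B. mon_deg m = d}" "b \<in> I" "f = g + b"
        unfolding I_def by (auto simp flip: set_add_polys_on[where n = n] simp: set_add_def')
      moreover have "f \<in> carrier ?R" "g \<in> carrier ?R"
        using f gb(1) by (auto simp: homogeneous_part_def polys_on_def)
      ultimately have "I +>\<^bsub>?R\<^esub> f = I +>\<^bsub>?R\<^esub> g"
        using R.quotient_eq_iff_same_a_r_cos[OF I, of f g]
        by (simp add: a_minus_def uminus_mpoly_ring)
      then show "I +>\<^bsub>?R\<^esub> f \<in> (+>\<^bsub>?R\<^esub>) I ` polys_on {m \<in> monomials n - B. mon_deg m = d}"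
        using gb(1) by blast
    qed
  qed
  moreover have "ring.dim (?R Quot I) ((+>\<^bsub>?R\<^esub>) I ` mpoly_consts) ((+>\<^bsub>?R\<^esub>) I ` polys_on {m \<in> monomials n - B. mon_deg m = d})
      = card {m \<in> monomials n - B. mon_deg m = d}" for d
    unfolding I_def
    by (rule dim_quotient_polys_on) (use I B in \<open>auto simp: I_def intro: finite_subset[OF _ fin]\<close>)
  ultimately show ?thesis
    by (simp add: quotient_hilbert_series_def hilbert_series_def)
qed

section \<open>Divisibility, square-free monomials and the generators of \<open>RLex\<close>\<close>

lemma mem_multiples_iff:
  assumes "m \<in> monomials n"
  shows "m \<in> multiples n G \<longleftrightarrow>
    (\<exists>g\<in>G. \<forall>l. Poly_Mapping.lookup g l \<le> Poly_Mapping.lookup m l)"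
proof
  assume "m \<in> multiples n G"
  then show "\<exists>g\<in>G. \<forall>l. Poly_Mapping.lookup g l \<le> Poly_Mapping.lookup m l"
    by (force simp: multiples_def lookup_add)
next
  assume "\<exists>g\<in>G. \<forall>l. Poly_Mapping.lookup g l \<le> Poly_Mapping.lookup m l"
  then obtain g where g: "g \<in> G" "\<And>l. Poly_Mapping.lookup g l \<le> Poly_Mapping.lookup m l"
    by blast
  \<comment> \<open>Subtraction of exponents is truncated; it is exact here because \<open>g\<close>
    is bounded by \<open>m\<close> pointwise.\<close>
  then have "m = (m - g) + g"
    by (intro poly_mapping_eqI) (simp add: lookup_add lookup_minus)
  moreover have "m - g \<in> monomials n"
    using assms by (auto simp: monomials_def in_keys_iff lookup_minus subset_iff)
  ultimately show "m \<in> multiples n G"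
    using g(1) unfolding multiples_def by blast
qed

text \<open>On finite index sets, \<open>Poly_Mapping.keys\<close> inverts this map, which turns
  counting square-free monomials by degree into counting sets by cardinality.\<close>

definition sf_mon :: "nat set \<Rightarrow> mon" where
  "sf_mon S = (\<Sum>l\<in>S. mon_var l)"

lemma lookup_sf_mon:
  "finite S \<Longrightarrow> Poly_Mapping.lookup (sf_mon S) l = (if l \<in> S then 1 else 0)"
  by (simp add: sf_mon_def mon_var_def lookup_sum lookup_single when_def)

lemma keys_sf_mon: "finite S \<Longrightarrow> Poly_Mapping.keys (sf_mon S) = S"
  by (auto simp: in_keys_iff lookup_sf_mon split: if_splits)

lemma mon_deg_sf_mon: "finite S \<Longrightarrow> mon_deg (sf_mon S) = card S"
  by (simp add: mon_deg_def keys_sf_mon lookup_sf_mon)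

lemma sf_mon_in_monomials: "finite S \<Longrightarrow> sf_mon S \<in> monomials n \<longleftrightarrow> S \<subseteq> {1..n}"
  by (simp add: monomials_def keys_sf_mon)

lemma mon_squarefree_iff: "mon_squarefree m \<longleftrightarrow> m = sf_mon (Poly_Mapping.keys m)"
proof
  assume sf: "mon_squarefree m"
  show "m = sf_mon (Poly_Mapping.keys m)"
  proof (rule poly_mapping_eqI)
    fix l
    have "Poly_Mapping.lookup m l \<le> 1"
      using sf by (simp add: mon_squarefree_def)
    then show "Poly_Mapping.lookup m l = Poly_Mapping.lookup (sf_mon (Poly_Mapping.keys m)) l"
      by (auto simp: lookup_sf_mon in_keys_iff)
  qed
next
  assume "m = sf_mon (Poly_Mapping.keys m)"
  then show "mon_squarefree m"
    by (metis finite_keys lookup_sf_mon mon_squarefree_def le_numeral_extra(4) zero_le)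
qed

lemma revlex_greater_sf_mon_iff:
  assumes "a < b" "i < j"
  shows "revlex_greater (sf_mon {a, b}) (sf_mon {i, j}) \<longleftrightarrow> b < j \<or> b = j \<and> a < i"
proof
  assume "revlex_greater (sf_mon {a, b}) (sf_mon {i, j})"
  \<comment> \<open>Exponents are 0 or 1, so at the last position of difference the smaller monomial
    has the variable and the greater one does not.\<close>
  then obtain l where l: "l \<notin> {a, b}" "l \<in> {i, j}"
    and gt: "\<And>l'. l < l' \<Longrightarrow> l' \<in> {a, b} \<longleftrightarrow> l' \<in> {i, j}"
    by (auto simp: revlex_greater_def lookup_sf_mon split: if_splits)
  from l(2) consider "l = i" | "l = j" by blast
  then show "b < j \<or> b = j \<and> a < i"
  proof cases
    case 1
    then show ?thesis using l gt[of j] gt[of b] gt[of a] assms by (cases "i < a") auto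
  next
    case 2
    then show ?thesis using l gt[of b] assms by (cases "j < b") auto
  qed
next
  assume "b < j \<or> b = j \<and> a < i"
  then have "\<exists>l. Poly_Mapping.lookup (sf_mon {a, b}) l < Poly_Mapping.lookup (sf_mon {i, j}) l \<and>
      (\<forall>l'>l. Poly_Mapping.lookup (sf_mon {a, b}) l' = Poly_Mapping.lookup (sf_mon {i, j}) l')"
    using assms
    \<comment> \<open>The last difference is at \<open>j\<close> if \<open>b < j\<close>; otherwise
      \<open>b = j\<close> cancels and it is at \<open>i\<close>, since
      \<open>a < i\<close>.\<close>
    by (intro exI[of _ "if b < j then j else i"]) (auto simp: lookup_sf_mon)
  then show "revlex_greater (sf_mon {a, b}) (sf_mon {i, j})"
    using assms by (simp add: revlex_greater_def mon_deg_sf_mon)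
qed

text \<open>The order itself gives \<open>a < i\<close> when \<open>b = j\<close>; the bound becomes
  \<open>a \<le> i\<close> because the monomial \<open>x_i x_j\<close> is a generator as
  well.\<close>

lemma RLex_gens_eq:
  assumes "1 \<le> i" "i < j" "j \<le> n"
  shows "RLex_gens n (mon_var i + mon_var j) =
    {sf_mon {a, b} | a b. 1 \<le> a \<and> a < b \<and> (b < j \<or> b = j \<and> a \<le> i)}"
proof -
  have ij: "mon_var i + mon_var j = sf_mon {i, j}"
    using assms by (simp add: sf_mon_def)
  have inj: "sf_mon {a, b} = sf_mon {i, j} \<longleftrightarrow> a = i \<and> b = j" if "a < b" for a b
    using that assms keys_sf_mon[of "{a, b}"] keys_sf_mon[of "{i, j}"]
    by (auto simp: doubleton_eq_iff)
  show ?thesis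
  proof (intro equalityI subsetI)
    fix m assume m: "m \<in> RLex_gens n (mon_var i + mon_var j)"
    then have m_eq: "m = sf_mon (Poly_Mapping.keys m)"
      by (simp add: RLex_gens_def mon_squarefree_iff)
    then have "card (Poly_Mapping.keys m) = 2"
      using m mon_deg_sf_mon[of "Poly_Mapping.keys m"] by (simp add: RLex_gens_def)
    then obtain x y where "Poly_Mapping.keys m = {x, y}" "x \<noteq> y"
      by (auto simp: card_2_iff)
    then obtain a b where ab: "Poly_Mapping.keys m = {a, b}" "a < b"
      by (metis insert_commute linorder_neqE_nat)
    then have "a \<ge> 1" using m by (auto simp: RLex_gens_def monomials_def)
    moreover have "b < j \<or> b = j \<and> a \<le> i"
      using m ab m_eq inj[of a b] revlex_greater_sf_mon_iff[OF ab(2) assms(2)]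
      by (auto simp: RLex_gens_def ij)
    ultimately show "m \<in> {sf_mon {a, b} | a b. 1 \<le> a \<and> a < b \<and> (b < j \<or> b = j \<and> a \<le> i)}"
      using m_eq ab by auto
  next
    fix m assume "m \<in> {sf_mon {a, b} | a b. 1 \<le> a \<and> a < b \<and> (b < j \<or> b = j \<and> a \<le> i)}"
    then obtain a b where "m = sf_mon {a, b}" "1 \<le> a" "a < b" "b < j \<or> b = j \<and> a \<le> i"
      by blast
    then show "m \<in> RLex_gens n (mon_var i + mon_var j)"
      using assms inj[of a b] revlex_greater_sf_mon_iff[of a b i j]
      by (auto simp: RLex_gens_def ij mon_squarefree_iff keys_sf_mon mon_deg_sf_mon sf_mon_in_monomials)
  qed
qed

text \<open>Index sets containing no pair that generates \<open>RLex\<close>; they index the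
  standard monomials of the quotient.\<close>

definition std_sets :: "nat \<Rightarrow> nat \<Rightarrow> nat \<Rightarrow> nat set set" where
  "std_sets i j n =
     {S. S \<subseteq> {1..n} \<and> (\<forall>a\<in>S. \<forall>b\<in>S. a < b \<longrightarrow> \<not> (b < j \<or> b = j \<and> a \<le> i))}"

lemma finite_std_sets: "finite (std_sets i j n)"
  by (rule finite_subset[of _ "Pow {1..n}"]) (auto simp: std_sets_def)

lemma finite_mem_std_sets: "S \<in> std_sets i j n \<Longrightarrow> finite S"
  by (auto simp: std_sets_def intro: finite_subset)

definition square_gens :: "nat \<Rightarrow> mon set" where
  "square_gens n = (\<lambda>l. Poly_Mapping.single l 2) ` {1..n}"

text \<open>Divisibility by a square removes exactly the monomials that are not square-free, and
  divisibility by \<open>x_a x_b\<close> with \<open>a < b\<close> removes exactly the sets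
  containing both \<open>a\<close> and \<open>b\<close>.\<close>

lemma standard_monomials_eq:
  assumes "1 \<le> i" "i < j" "j \<le> n"
  shows "monomials n - multiples n (square_gens n \<union> RLex_gens n (mon_var i + mon_var j)) =
    sf_mon ` std_sets i j n" (is "?L = ?R")
proof -
  have sq: "m \<in> multiples n (square_gens n) \<longleftrightarrow> \<not> mon_squarefree m" if m: "m \<in> monomials n" for m
  proof -
    have "l \<in> {1..n}" if "\<not> Poly_Mapping.lookup m l \<le> 1" for l
      using that m by (auto simp: monomials_def in_keys_iff subset_iff)
    moreover have "(\<forall>l'. Poly_Mapping.lookup (Poly_Mapping.single l 2) l' \<le> Poly_Mapping.lookup m l') \<longleftrightarrow>
        \<not> Poly_Mapping.lookup m l \<le> 1" for l
      by (auto simp: lookup_single when_def)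
    ultimately show ?thesis
      unfolding mem_multiples_iff[OF m] square_gens_def mon_squarefree_def by blast
  qed
  have rl: "sf_mon S \<in> multiples n (RLex_gens n (mon_var i + mon_var j)) \<longleftrightarrow> S \<notin> std_sets i j n"
    if "S \<subseteq> {1..n}" for S
  proof -
    have fin: "finite S" using that finite_subset by blast
    have "(\<forall>l. Poly_Mapping.lookup (sf_mon {a, b}) l \<le> Poly_Mapping.lookup (sf_mon S) l) \<longleftrightarrow>
        a \<in> S \<and> b \<in> S" for a b
      using fin by (auto simp: lookup_sf_mon)
    moreover have "sf_mon S \<in> monomials n"
      using fin that by (simp add: sf_mon_in_monomials)
    ultimately have "sf_mon S \<in> multiples n (RLex_gens n (mon_var i + mon_var j)) \<longleftrightarrow>
        (\<exists>a b. 1 \<le> a \<and> a < b \<and> (b < j \<or> b = j \<and> a \<le> i) \<and> a \<in> S \<and> b \<in> S)"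
      unfolding RLex_gens_eq[OF assms] by (subst mem_multiples_iff) auto
    also have "\<dots> \<longleftrightarrow> S \<notin> std_sets i j n"
      using that unfolding std_sets_def by fastforce
    finally show ?thesis .
  qed
  show ?thesis
  proof (intro equalityI subsetI)
    fix m assume m: "m \<in> ?L"
    then have "m = sf_mon (Poly_Mapping.keys m)" "Poly_Mapping.keys m \<subseteq> {1..n}"
      using sq[of m] by (auto simp: multiples_Un mon_squarefree_iff monomials_def)
    then show "m \<in> ?R"
      using m rl[of "Poly_Mapping.keys m"] by (auto simp: multiples_Un)
  next
    fix m assume "m \<in> ?R"
    then obtain S where S: "S \<in> std_sets i j n" "m = sf_mon S" by blast
    then have "finite S" "S \<subseteq> {1..n}"
      by (auto simp: finite_mem_std_sets std_sets_def)
    then show "m \<in> ?L"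
      using S sq[of m] rl[of S]
      by (auto simp: multiples_Un mon_squarefree_iff keys_sf_mon sf_mon_in_monomials)
  qed
qed

section \<open>The Hilbert polynomial\<close>

text \<open>In a standard set within \<open>{1..j}\<close>, elements \<open>a < b\<close> force
  \<open>b = j\<close> and \<open>i < a\<close>. Taking \<open>a\<close> to be the minimum shows
  that any further element is \<open>j\<close>.\<close>

lemma std_sets_base:
  assumes "i < j"
  shows "std_sets i j j = insert {} ((\<lambda>a. {a}) ` {1..j} \<union> (\<lambda>a. {a, j}) ` {i<..<j})"
proof (intro equalityI subsetI)
  fix S assume S: "S \<in> std_sets i j j"
  then have fin: "finite S" and sub: "S \<subseteq> {1..j}"
    by (auto simp: finite_mem_std_sets std_sets_def)
  have pair: "\<not> (b < j \<or> b = j \<and> a \<le> i)" if "a \<in> S" "b \<in> S" "a < b" for a b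
    using S that unfolding std_sets_def by blast
  show "S \<in> insert {} ((\<lambda>a. {a}) ` {1..j} \<union> (\<lambda>a. {a, j}) ` {i<..<j})"
  proof (cases "S = {}")
    case False
    define a where "a = Min S"
    have a: "a \<in> S" "\<And>b. b \<in> S \<Longrightarrow> a \<le> b"
      using fin False by (auto simp: a_def)
    have others: "b = j \<and> i < a" if "b \<in> S" "b \<noteq> a" for b
      using pair[OF a(1) that(1)] a(2)[OF that(1)] that sub by fastforce
    show ?thesis
    proof (cases "S = {a}")
      case True
      then show ?thesis using sub by auto
    next
      case False
      then obtain b where b: "b \<in> S" "b \<noteq> a" using a(1) by blast
      then have "S = {a, j}" using others a(1) by blast
      moreover have "a \<in> {i<..<j}" using others[OF b] a(2)[OF b(1)] b by auto
      ultimately show ?thesis by blast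
    qed
  qed simp
qed (use assms in \<open>auto simp: std_sets_def\<close>)

text \<open>Since \<open>Suc n > j\<close>, the new index takes part in no forbidden pair and can be
  added or omitted freely.\<close>

lemma std_sets_Suc:
  assumes "j \<le> n"
  shows "std_sets i j (Suc n) = std_sets i j n \<union> insert (Suc n) ` std_sets i j n"
proof (intro equalityI subsetI)
  fix S assume S: "S \<in> std_sets i j (Suc n)"
  then have rem: "S - {Suc n} \<in> std_sets i j n"
    unfolding std_sets_def by (auto simp: subset_iff le_Suc_eq)
  show "S \<in> std_sets i j n \<union> insert (Suc n) ` std_sets i j n"
  proof (cases "Suc n \<in> S")
    case True
    then show ?thesis using rem by (metis UnI2 image_eqI insert_Diff)
  next
    case False
    then show ?thesis using rem by simp
  qed
next
  fix S assume "S \<in> std_sets i j n \<union> insert (Suc n) ` std_sets i j n"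
  then show "S \<in> std_sets i j (Suc n)"
    using assms unfolding std_sets_def by (fastforce simp: subset_iff)
qed

text \<open>The natural-number subtractions are exact wherever \<open>i < j\<close> and
  \<open>j \<le> n\<close>; \<open>j - i - 1\<close> counts the \<open>a\<close> with
  \<open>i < a < j\<close>.\<close>

definition hilbert_poly :: "nat \<Rightarrow> nat \<Rightarrow> nat \<Rightarrow> real poly" where
  "hilbert_poly i j n = [:1, real j, real (j - i - 1):] * [:1, 1:] ^ (n - j)"

text \<open>The generating polynomial of standard sets by cardinality, computed by induction on
  \<open>n\<close> starting from \<open>j\<close>: each further variable contributes a factor
  \<open>1 + t\<close>.\<close>

lemma sum_std_sets:
  assumes "i < j" "j \<le> n"
  shows "(\<Sum>S\<in>std_sets i j n. Polynomial.monom 1 (card S)) = hilbert_poly i j n"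
  using assms(2)
proof (induction n rule: dec_induct)
  case base
  have inj: "inj_on (\<lambda>a. {a}) {1..j}" "inj_on (\<lambda>a. {a, j}) {i<..<j}"
    by (auto simp: inj_on_def doubleton_eq_iff)
  have "(\<Sum>S\<in>std_sets i j j. Polynomial.monom (1::real) (card S)) =
      1 + ((\<Sum>a\<in>{1..j}. Polynomial.monom 1 (card {a})) + (\<Sum>a\<in>{i<..<j}. Polynomial.monom 1 (card {a, j})))"
    unfolding std_sets_base[OF assms(1)]
    by (subst sum.insert, simp, force, subst sum.union_disjoint)
      (use inj in \<open>auto simp: sum.reindex\<close>)
  also have "(\<Sum>a\<in>{i<..<j}. Polynomial.monom (1::real) (card {a, j})) =
      (\<Sum>a\<in>{i<..<j}. Polynomial.monom 1 2)"
    by (rule sum.cong) (auto simp: numeral_2_eq_2)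
  also have "1 + ((\<Sum>a\<in>{1..j}. Polynomial.monom (1::real) (card {a})) + (\<Sum>a\<in>{i<..<j}. Polynomial.monom 1 2)) =
      hilbert_poly i j j"
    by (rule poly_eqI)
      (auto simp: hilbert_poly_def coeff_pCons of_nat_poly numeral_2_eq_2 split: nat.split)
  finally show ?case .
next
  case (step n)
  have notin: "Suc n \<notin> S" if "S \<in> std_sets i j n" for S
    using that by (auto simp: std_sets_def)
  then have disj: "std_sets i j n \<inter> insert (Suc n) ` std_sets i j n = {}"
    by auto
  have inj: "inj_on (insert (Suc n)) (std_sets i j n)"
    by (rule inj_onI) (metis notin insert_ident)
  have "(\<Sum>S\<in>std_sets i j (Suc n). Polynomial.monom (1::real) (card S)) =
      (\<Sum>S\<in>std_sets i j n. Polynomial.monom 1 (card S)) +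
      (\<Sum>S\<in>std_sets i j n. Polynomial.monom 1 (card (insert (Suc n) S)))"
    by (simp add: std_sets_Suc[OF step.hyps(1)] sum.union_disjoint finite_std_sets disj sum.reindex[OF inj])
  \<comment> \<open>A new element raises the cardinality by one, which is multiplication by the
    indeterminate \<open>[:0, 1:]\<close>.\<close>
  also have "(\<Sum>S\<in>std_sets i j n. Polynomial.monom (1::real) (card (insert (Suc n) S))) =
      (\<Sum>S\<in>std_sets i j n. [:0, 1:] * Polynomial.monom 1 (card S))"
    by (rule sum.cong) (auto simp: notin finite_mem_std_sets monom_Suc)
  also have "(\<Sum>S\<in>std_sets i j n. Polynomial.monom (1::real) (card S)) + \<dots> =
      [:1, 1:] * hilbert_poly i j n"
    by (simp add: step.IH flip: sum_distrib_left del: mult_pCons_left) simp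
  also have "\<dots> = hilbert_poly i j (Suc n)"
    using step.hyps by (simp add: hilbert_poly_def Suc_diff_le mult_ac del: mult_pCons_left mult_pCons_right)
  finally show ?case .
qed

lemma card_standard_monomials:
  assumes "i < j" "j \<le> n"
  shows "real (card {m \<in> sf_mon ` std_sets i j n. mon_deg m = d}) = poly.coeff (hilbert_poly i j n) d"
proof -
  have "{m \<in> sf_mon ` std_sets i j n. mon_deg m = d} = sf_mon ` {S \<in> std_sets i j n. card S = d}"
    by (auto simp: mon_deg_sf_mon finite_mem_std_sets)
  moreover have "inj_on sf_mon {S \<in> std_sets i j n. card S = d}"
    by (rule inj_on_inverseI[of _ Poly_Mapping.keys]) (auto simp: keys_sf_mon finite_mem_std_sets)
  ultimately have "card {m \<in> sf_mon ` std_sets i j n. mon_deg m = d} = card {S \<in> std_sets i j n. card S = d}"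
    by (simp add: card_image)
  also have "real \<dots> = (\<Sum>S\<in>std_sets i j n. if card S = d then 1 else 0)"
    by (simp add: sum.If_cases finite_std_sets Int_def)
  also have "\<dots> = poly.coeff (\<Sum>S\<in>std_sets i j n. Polynomial.monom 1 (card S)) d"
    by (simp add: coeff_sum)
  finally show ?thesis
    using sum_std_sets[OF assms] by simp
qed

lemma quotient_hilbert_series_eq:
  fixes I :: "'k::field mpoly set"
  assumes "1 \<le> i" "i < j" "j \<le> n"
    and I: "I = squares_ideal n <+>\<^bsub>mpoly_ring n\<^esub> RLex n (mon_var i + mon_var j)"
  shows "quotient_hilbert_series n I = fps_of_poly (hilbert_poly i j n)"
proof -
  let ?G = "square_gens n \<union> RLex_gens n (mon_var i + mon_var j)"
  have G: "square_gens n \<subseteq> monomials n" "RLex_gens n (mon_var i + mon_var j) \<subseteq> monomials n"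
    by (auto simp: square_gens_def RLex_gens_def monomials_def)
  have "mpoly_of_mon (mon_var l) ^ 2 = (mpoly_of_mon (Poly_Mapping.single l 2) :: 'k mpoly)" for l
    by (simp add: mpoly_of_mon_def mon_var_def power2_eq_square mult_single numeral_2_eq_2 flip: single_add)
  then have "squares_ideal n = (Idl\<^bsub>mpoly_ring n\<^esub> (mpoly_of_mon ` square_gens n) :: 'k mpoly set)"
    by (simp add: squares_ideal_def square_gens_def image_image)
  then have I_eq: "I = polys_on (multiples n ?G)"
    by (simp add: I RLex_def genideal_mpoly_of_mon G set_add_polys_on multiples_Un)
  have "monomials n - multiples n ?G = sf_mon ` std_sets i j n"
    by (rule standard_monomials_eq[OF assms(1-3)])
  \<comment> \<open>The monomial 1 comes from the empty set and is standard, so the exponent 0 is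
    not in the ideal's set of monomials.\<close>
  moreover have "0 \<in> sf_mon ` std_sets i j n"
    by (rule image_eqI[of _ _ "{}"]) (auto simp: sf_mon_def std_sets_def)
  moreover have "ideal I (mpoly_ring n)"
    unfolding I_eq by (rule ideal_multiples) (use G in auto)
  moreover have "multiples n ?G \<subseteq> monomials n"
    using G by (intro multiples_subset) auto
  ultimately have "quotient_hilbert_series n I =
      Abs_fps (\<lambda>d. real (card {m \<in> sf_mon ` std_sets i j n. mon_deg m = d}))"
    unfolding I_eq using quotient_hilbert_series_polys_on[of "multiples n ?G" n]
    by (auto simp: finite_std_sets)
  then show ?thesis
    by (simp add: card_standard_monomials[OF assms(2,3)] fps_of_poly_def)
qed

section \<open>Real-rootedness, log-concavity and symmetry\<close>

lemma map_poly_of_real_mult: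
  "map_poly complex_of_real (p * q) = map_poly complex_of_real p * map_poly complex_of_real q"
  by (rule poly_eqI) (simp add: coeff_map_poly coeff_mult)

lemma map_poly_of_real_power:
  "map_poly complex_of_real (p ^ n) = map_poly complex_of_real p ^ n"
  by (induction n) (simp_all add: map_poly_of_real_mult)

text \<open>The factors \<open>1 + t\<close> have root -1. Real and imaginary parts are used for the
  quadratic, which also covers the degenerate case of leading coefficient 0.\<close>

lemma real_rooted_hilbert_poly:
  assumes "i < j" "1 \<le> i"
  shows "real_rooted (hilbert_poly i j n)"
  unfolding real_rooted_def
proof (intro allI impI)
  fix z :: complex
  assume "poly (map_poly complex_of_real (hilbert_poly i j n)) z = 0"
  moreover have "poly (map_poly complex_of_real (hilbert_poly i j n)) z =
      (1 + of_nat j * z + of_nat (j - i - 1) * z\<^sup>2) * (1 + z) ^ (n - j)"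
    unfolding hilbert_poly_def map_poly_of_real_mult map_poly_of_real_power poly_mult poly_power
    by (simp add: map_poly_pCons power2_eq_square algebra_simps)
  ultimately consider "1 + z = 0" | "1 + of_nat j * z + of_nat (j - i - 1) * z\<^sup>2 = 0"
    by auto
  then show "z \<in> \<real>"
  proof cases
    case 1
    then have "z = of_real (- 1)" by (simp add: add_eq_0_iff)
    then show ?thesis by (metis Reals_of_real)
  next
    case 2
    define b c x y where "b = real j" and "c = real (j - i - 1)" and "x = Re z" and "y = Im z"
    have re: "1 + b * x + c * (x\<^sup>2 - y\<^sup>2) = 0"
      using arg_cong[OF 2, of Re] by (simp add: b_def c_def x_def y_def power2_eq_square)
    have im: "(b + 2 * c * x) * y = 0"
      using arg_cong[OF 2, of Im] by (simp add: b_def c_def x_def y_def power2_eq_square algebra_simps)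
    have "c \<le> b - 2" "c \<ge> 0"
      using assms by (auto simp: b_def c_def)
    \<comment> \<open>From \<open>c \<le> b - 2\<close> one gets
      \<open>b^2 - 4c \<ge> (b - 2)^2 + 4\<close>.\<close>
    then have disc: "b\<^sup>2 > 4 * c"
      using zero_le_power2[of "b - 2"] by (simp add: power2_eq_square algebra_simps)
    have "y = 0"
    proof (rule ccontr)
      assume "y \<noteq> 0"
      then have b: "b = - 2 * c * x" using im by simp
      \<comment> \<open>With \<open>b = - 2 * c * x\<close>, the negated discriminant is a multiple
        of the vanishing real part plus a square.\<close>
      have "4 * c - b\<^sup>2 = 4 * c * (1 + b * x + c * (x\<^sup>2 - y\<^sup>2)) + (2 * c * y)\<^sup>2"
        by (simp add: b power2_eq_square algebra_simps)
      also have "\<dots> \<ge> 0" by (simp add: re)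
      finally show False using disc by simp
    qed
    then show ?thesis by (simp add: complex_is_Real_iff y_def)
  qed
qed

section \<open>Log-concavity and unimodality\<close>

text \<open>Positivity up to the degree rules out internal zeros; it is what makes log-concavity
  survive multiplication by \<open>1 + t\<close> and imply unimodality. The indices
  \<open>d\<close>, \<open>d + 1\<close>, \<open>d + 2\<close> avoid subtraction, and the inequality
  is trivial once \<open>d + 2\<close> exceeds the degree.\<close>

definition pos_log_concave :: "real poly \<Rightarrow> bool" where
  "pos_log_concave p \<longleftrightarrow> (\<forall>d\<le>Polynomial.degree p. poly.coeff p d > 0) \<and>
     (\<forall>d. poly.coeff p d * poly.coeff p (d + 2) \<le> (poly.coeff p (d + 1))\<^sup>2)"

lemma coeff_times_one_plus_X:
  "poly.coeff ([:1, 1:] * p :: real poly) d = poly.coeff p d + (case d of 0 \<Rightarrow> 0 | Suc e \<Rightarrow> poly.coeff p e)"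
  by (simp add: coeff_pCons split: nat.split)

text \<open>With new coefficients \<open>h_d + h_(d-1)\<close>, the inequality expands into
  log-concavity at two neighbouring places and the mixed inequality
  \<open>h_(d-1) h_(d+2) \<le> h_d h_(d+1)\<close>.\<close>

lemma pos_log_concave_times_one_plus_X:
  assumes "pos_log_concave p"
  shows "pos_log_concave ([:1, 1:] * p)"
proof -
  let ?h = "poly.coeff p" and ?D = "Polynomial.degree p"
  have pos: "?h d > 0" if "d \<le> ?D" for d
    using assms that by (auto simp: pos_log_concave_def)
  have lc: "?h d * ?h (d + 2) \<le> (?h (d + 1))\<^sup>2" for d
    using assms by (auto simp: pos_log_concave_def)
  have nonneg: "?h d \<ge> 0" for d
    using pos[of d] by (cases "d \<le> ?D") (auto simp: coeff_eq_0 intro: less_imp_le)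
  have "p \<noteq> 0" using pos[of 0] by auto
  then have deg: "Polynomial.degree ([:1, 1:] * p) = Suc ?D"
    by (subst Polynomial.degree_mult_eq) auto
  \<comment> \<open>Multiply two consecutive log-concavity inequalities and cancel
    \<open>h_(d+1) h_(d+2)\<close>, which is positive up to the degree; beyond it the left side is
    0.\<close>
  have cross: "?h d * ?h (d + 3) \<le> ?h (d + 1) * ?h (d + 2)" for d
  proof (cases "d + 3 \<le> ?D")
    case True
    have "(?h d * ?h (d + 2)) * (?h (d + 1) * ?h (d + 3)) \<le> (?h (d + 1))\<^sup>2 * (?h (d + 2))\<^sup>2"
      using lc[of d] lc[of "d + 1"] nonneg
      by (intro mult_mono) (auto simp: numeral_eq_Suc)
    then have "(?h (d + 1) * ?h (d + 2)) * (?h d * ?h (d + 3)) \<le>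
        (?h (d + 1) * ?h (d + 2)) * (?h (d + 1) * ?h (d + 2))"
      by (simp add: power2_eq_square mult_ac)
    moreover have "?h (d + 1) * ?h (d + 2) > 0"
      using True by (intro mult_pos_pos pos) auto
    ultimately show ?thesis by (rule mult_left_le_imp_le)
  next
    case False
    then show ?thesis using nonneg by (simp add: coeff_eq_0)
  qed
  show ?thesis
    unfolding pos_log_concave_def deg
  proof (intro conjI allI impI)
    fix d assume "d \<le> Suc ?D"
    then show "poly.coeff ([:1, 1:] * p) d > 0"
      using pos[of d] pos[of "d - 1"] nonneg[of d]
      by (cases d) (auto simp: coeff_pCons intro: add_nonneg_pos)
  next
    fix d
    \<comment> \<open>The coefficient preceding \<open>d\<close>, with value 0 at
      \<open>d = 0\<close>.\<close>
    let ?a = "case d of 0 \<Rightarrow> 0 | Suc e \<Rightarrow> ?h e"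
    have "?a * ?h (d + 1) \<le> (?h d)\<^sup>2" "?a * ?h (d + 2) \<le> ?h d * ?h (d + 1)"
      using lc[of "d - 1"] cross[of "d - 1"] nonneg
      by (auto simp: numeral_eq_Suc split: nat.split)
    then show "poly.coeff ([:1, 1:] * p) d * poly.coeff ([:1, 1:] * p) (d + 2) \<le>
        (poly.coeff ([:1, 1:] * p) (d + 1))\<^sup>2"
      using lc[of d] unfolding coeff_times_one_plus_X
      by (simp add: power2_eq_square algebra_simps)
  qed
qed

text \<open>For the quadratic factor the inequality is \<open>c \<le> j \<le> j^2\<close>. If
  \<open>c = 0\<close> its degree drops to 1 and positivity is only asked up to there.\<close>

lemma pos_log_concave_hilbert_poly:
  assumes "i < j"
  shows "pos_log_concave (hilbert_poly i j n)"
proof -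
  define c where "c = j - i - 1"
  have "pos_log_concave [:1, real j, real c:]"
    unfolding pos_log_concave_def
  proof (intro conjI allI impI)
    fix d assume "d \<le> Polynomial.degree [:1, real j, real c:]"
    then show "poly.coeff [:1, real j, real c:] d > 0"
      using assms by (auto simp: coeff_pCons split: nat.splits if_splits)
  next
    have "real c \<le> real j * 1" using c_def by simp
    also have "\<dots> \<le> real j * real j" using assms by (intro mult_left_mono) auto
    finally show "poly.coeff [:1, real j, real c:] d * poly.coeff [:1, real j, real c:] (d + 2) \<le>
        (poly.coeff [:1, real j, real c:] (d + 1))\<^sup>2" for d
      by (auto simp: coeff_pCons power2_eq_square split: nat.split)
  qed
  then have "pos_log_concave ([:1, 1:] ^ m * [:1, real j, real c:])" for m
    by (induction m)
      (simp_all only: power_0 mult_1 power_Suc mult.assoc pos_log_concave_times_one_plus_X)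
  then show ?thesis
    by (simp only: hilbert_poly_def c_def mult.commute)
qed

lemma pos_log_concave_imp_log_concave_seq:
  assumes "pos_log_concave p"
  shows "log_concave_seq (poly.coeff p) (Polynomial.degree p)"
  unfolding log_concave_seq_def
proof (intro allI impI)
  fix d assume "0 < d \<and> d < Polynomial.degree p"
  then obtain e where "d = Suc e" by (cases d) auto
  then show "poly.coeff p (d - 1) * poly.coeff p (d + 1) \<le> (poly.coeff p d)\<^sup>2"
    using assms by (auto simp: pos_log_concave_def)
qed

lemma pos_log_concave_imp_unimodal_seq:
  assumes "pos_log_concave p"
  shows "unimodal_seq (poly.coeff p) (Polynomial.degree p)"
proof -
  let ?h = "poly.coeff p" and ?D = "Polynomial.degree p"
  \<comment> \<open>The peak is the first index at which the sequence stops increasing strictly;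
    \<open>?D\<close> always qualifies, so the minimum exists and is at most
    \<open>?D\<close>.\<close>
  define m where "m = (LEAST d. d = ?D \<or> ?h (Suc d) \<le> ?h d)"
  have m: "m = ?D \<or> ?h (Suc m) \<le> ?h m"
    unfolding m_def by (rule LeastI[of _ ?D]) simp
  have "m \<le> ?D" unfolding m_def by (rule Least_le) simp
  moreover have "?h d \<le> ?h (Suc d)" if "d < m" for d
    using not_less_Least[of d "\<lambda>d. d = ?D \<or> ?h (Suc d) \<le> ?h d"] that unfolding m_def by auto
  moreover have "?h (Suc d) \<le> ?h d" if "m \<le> d" "d < ?D" for d
    using that
  proof (induction d rule: dec_induct)
    case base
    then show ?case using m by auto
  next
    case (step d)
    \<comment> \<open>A descent propagates: replace \<open>h_(d+1)\<close> by the larger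
      \<open>h_d\<close>, apply log-concavity, and cancel the positive
      \<open>h_(d+1)\<close>.\<close>
    have "?h (Suc d) * ?h (Suc (Suc d)) \<le> ?h d * ?h (Suc (Suc d))"
      using step assms by (intro mult_right_mono) (auto simp: pos_log_concave_def intro: less_imp_le)
    also have "\<dots> \<le> ?h (Suc d) * ?h (Suc d)"
      using assms by (auto simp: pos_log_concave_def power2_eq_square)
    finally have "?h (Suc d) * ?h (Suc (Suc d)) \<le> ?h (Suc d) * ?h (Suc d)" .
    moreover have "?h (Suc d) > 0"
      using step.prems assms by (auto simp: pos_log_concave_def)
    ultimately show ?case by (rule mult_left_le_imp_le)
  qed
  ultimately show ?thesis
    unfolding unimodal_seq_def by blast
qed

section \<open>Symmetry\<close>

text \<open>Since \<open>reflect_poly\<close> is multiplicative, this form allows symmetry of a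
  product to be checked on its factors.\<close>

lemma symmetric_poly_iff_reflect: "symmetric_poly p \<longleftrightarrow> reflect_poly p = p"
proof -
  have "poly.coeff (reflect_poly p) d = poly.coeff p d \<longleftrightarrow>
      (d \<le> Polynomial.degree p \<longrightarrow> poly.coeff p d = poly.coeff p (Polynomial.degree p - d))" for d
    by (auto simp: coeff_reflect_poly coeff_eq_0)
  then show ?thesis
    by (simp add: symmetric_poly_def poly_eq_iff)
qed

lemma symmetric_hilbert_poly_iff:
  assumes "1 \<le> i" "i < j"
  shows "symmetric_poly (hilbert_poly i j n) \<longleftrightarrow> j - i - 1 = 1"
proof
  assume "j - i - 1 = 1"
  then have "reflect_poly [:1, real j, real (j - i - 1):] = [:1, real j, real (j - i - 1):]"
    by (simp add: reflect_poly_def)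
  moreover have "reflect_poly [:1, 1::real:] = [:1, 1:]"
    by (simp add: reflect_poly_def)
  ultimately show "symmetric_poly (hilbert_poly i j n)"
    unfolding symmetric_poly_iff_reflect hilbert_poly_def reflect_poly_mult reflect_poly_power
    by (simp only:)
next
  assume "symmetric_poly (hilbert_poly i j n)"
  then have "poly.coeff (hilbert_poly i j n) 0 =
      poly.coeff (hilbert_poly i j n) (Polynomial.degree (hilbert_poly i j n) - 0)"
    unfolding symmetric_poly_def by (elim allE[of _ 0]) (simp only: le0)
  then have "lead_coeff (hilbert_poly i j n) = poly.coeff (hilbert_poly i j n) 0"
    by simp
  also have "\<dots> = 1"
    by (simp add: hilbert_poly_def coeff_mult_0 coeff_0_power del: mult_pCons_left)
  \<comment> \<open>The factors \<open>1 + t\<close> are monic. If \<open>j - i - 1 = 0\<close>, the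
    leading coefficient is \<open>j\<close>, which is at least 2 and so cannot equal 1.\<close>
  also have "lead_coeff (hilbert_poly i j n) = lead_coeff [:1, real j, real (j - i - 1):]"
    unfolding hilbert_poly_def lead_coeff_mult lead_coeff_power by simp
  finally show "j - i - 1 = 1"
    using assms by (auto split: if_splits)
qed

theorem corollary2p4:
  fixes n i j :: nat
    and I :: "'k::field mpoly set"
  assumes "1 \<le> i" and "i < j" and "j \<le> n"
    and "I = squares_ideal n <+>\<^bsub>mpoly_ring n\<^esub> RLex n (mon_var i + mon_var j)"
  shows "\<exists>h :: real poly.
    quotient_hilbert_series n I = fps_of_poly h \<and>
    real_rooted h \<and>
    unimodal_seq (poly.coeff h) (Polynomial.degree h) \<and>
    log_concave_seq (poly.coeff h) (Polynomial.degree h) \<and>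
    (symmetric_poly h \<longleftrightarrow> j - i - 1 = 1)"
proof (intro exI conjI)
  show "quotient_hilbert_series n I = fps_of_poly (hilbert_poly i j n)"
    by (rule quotient_hilbert_series_eq[OF assms])
  show "real_rooted (hilbert_poly i j n)"
    by (rule real_rooted_hilbert_poly[OF assms(2,1)])
  note lc = pos_log_concave_hilbert_poly[OF assms(2)]
  show "unimodal_seq (poly.coeff (hilbert_poly i j n)) (Polynomial.degree (hilbert_poly i j n))"
    by (rule pos_log_concave_imp_unimodal_seq[OF lc])
  show "log_concave_seq (poly.coeff (hilbert_poly i j n)) (Polynomial.degree (hilbert_poly i j n))"
    by (rule pos_log_concave_imp_log_concave_seq[OF lc])
  show "symmetric_poly (hilbert_poly i j n) \<longleftrightarrow> j - i - 1 = 1"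
    by (rule symmetric_hilbert_poly_iff[OF assms(1,2)])
qed

end
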